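(* Let $E$ be the Adamchik function, ${\mathcal S}_3$ the Kurokawa triple sine function, and ${\mathcal C}_3$ the Kurokawa--Koyama triple cosine function. Then the following identity holds, as an identity of meromorphic functions of $x \in \mathbb{C}$: $$E(x) = e^{2x^2} \, \frac{{\mathcal S}_3(2x)}{{\mathcal S}_3(x)^8} = e^{2x^2} \, \frac{{\mathcal C}_3(x)^8}{{\mathcal S}_3(2x)}.$$
   Context: The Adamchik function is defined by $$E(x) = \lim_{N \to \infty} \prod_{k=1}^{2N} \left( 1 - \frac{4x^2}{k^2} \right)^{k^2(-1)^{k+1}},$$ and it also has the expression $$E(x) = \prod_{k \geq 1} \left(e^{4x^2}\left(1 - \frac{4x^2}{k^2}\right)^{k^2}\right)^{(-1)^{k+1}}.$$ The Kurokawa triple sine function is $${\mathcal S}_3(x) = e^{\frac{x^2}{2}} \prod_{n \geq 1} \left(e^{x^2}\left(1 - \frac{x^2}{n^2}\right)^{n^2}\right).$$ The Kurokawa--Koyama triple cosine function is $${\mathcal C}_3(x) = \prod_{n \geq 1} \left(e^{x^2} \left(1 - \frac{4x^2}{(2n- 1)^2}\right)^{\frac{(2n-1)^2}{4}}\right).$$ The exponents $\frac{(2n-1)^2}{4}$ are not integers, but only the eighth power of ${\mathcal C}_3$ is used here, and it is unambiguous: $${\mathcal C}_3(x)^8 = \prod_{n \geq 1} \left(e^{8x^2} \left(1 - \frac{4x^2}{(2n- 1)^2}\right)^{2(2n-1)^2}\right).$$ *)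

theory Defs
  imports "HOL-Complex_Analysis.Complex_Analysis"
begin

text \<open>
  Integer powers follow the convention \<open>inverse 0 = 0\<close>, so that \<open>adamchik_E\<close> takes the
  value 0 at its poles, the nonzero integers.
\<close>

definition adamchik_E :: "complex \<Rightarrow> complex" where
  "adamchik_E x = lim (\<lambda>N. \<Prod>k=1..2*N. (1 - 4 * x^2 / of_nat k ^ 2) powi (int k ^ 2 * (-1) ^ (k + 1)))"

text \<open>The library's infinite products start at index 0, hence the shift of the index by one.\<close>

definition triple_sine :: "complex \<Rightarrow> complex" where
  "triple_sine x = exp (x^2 / 2) *
     (\<Prod>n. exp (x^2) * (1 - x^2 / of_nat (n + 1) ^ 2) ^ ((n + 1) ^ 2))"

text \<open>
  The exponents are quarter-integers. Each factor is read with the principal branch of the power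
  (and \<open>0 powr a = 0\<close>); by \<open>triple_cosine_power8\<close> below, the eighth power is the product with
  integer exponents, which does not involve a choice of branch.
\<close>

definition triple_cosine :: "complex \<Rightarrow> complex" where
  "triple_cosine x =
     (\<Prod>n. exp (x^2) * (1 - 4 * x^2 / of_nat (2 * n + 1) ^ 2) powr (of_nat (2 * n + 1) ^ 2 / 4))"

lemma convergent_prod_exp_powr:
  fixes w :: complex and t :: "nat \<Rightarrow> real" and s :: "nat \<Rightarrow> int"
  assumes t_pos: "\<And>n. t n > 0" and t_sum: "summable (\<lambda>n. 1 / t n)"
    and s: "\<And>n. s n = 1 \<or> s n = -1"
  shows "convergent_prod (\<lambda>n. (exp w * (1 - w / of_real (t n)) powr of_real (t n)) powi s n)"
proof -
  define g where "g n = w + of_real (t n) * Ln (1 - w / of_real (t n))" for n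
  have "(\<lambda>n. 1 / t n) \<longlonglongrightarrow> 0"
    using t_sum by (rule summable_LIMSEQ_zero)
  hence "eventually (\<lambda>n. 1 / t n < 1 / (2 * (norm w + 1))) sequentially"
    by (rule order_tendstoD) (simp add: add_nonneg_pos)
  hence ev: "eventually (\<lambda>n. 2 * (norm w + 1) < t n) sequentially"
  proof eventually_elim
    case (elim n)
    have "2 * (norm w + 1) > 0" by (simp add: add_nonneg_pos)
    with elim t_pos[of n] show ?case by (simp add: field_simps)
  qed
  then obtain N where N: "\<And>n. n \<ge> N \<Longrightarrow> 2 * (norm w + 1) < t n"
    by (auto simp: eventually_sequentially)
  have small: "norm (w / of_real (t n)) < 1/2" if "n \<ge> N" for n
  proof -
    have "norm (w / of_real (t n)) = norm w / t n"
      using t_pos[of n] by (simp add: norm_divide)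
    also have "\<dots> < 1/2"
      using N[OF that] t_pos[of n] by (simp add: field_simps)
    finally show ?thesis .
  qed
  have bound: "norm (g n) \<le> 2 * norm w ^ 2 * (1 / t n)" if n: "n \<ge> N" for n
  proof -
    define z where "z = - (w / of_real (t n))"
    have z: "norm z < 1/2" using small[OF n] by (simp add: z_def)
    have tz: "of_real (t n) * z = - w"
      using t_pos[of n] by (simp add: z_def)
    have "g n = of_real (t n) * (Ln (1 + z) - z)"
      using tz by (simp add: g_def z_def algebra_simps)
    hence "norm (g n) = t n * norm (Ln (1 + z) - z)"
      using t_pos[of n] by (simp add: norm_mult)
    also have "\<dots> \<le> t n * (norm z ^ 2 / (1 - norm z))"
      using z t_pos[of n] by (intro mult_left_mono Ln_approx_linear) auto
    also have "\<dots> \<le> t n * (norm z ^ 2 / (1/2))"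
      using z t_pos[of n] by (intro mult_left_mono divide_left_mono) auto
    also have "\<dots> = 2 * norm w ^ 2 * (1 / t n)"
      using t_pos[of n] by (simp add: z_def norm_divide field_simps power2_eq_square)
    finally show ?thesis .
  qed
  have "summable (\<lambda>n. of_int (s n) * g n)"
  proof (rule summable_comparison_test)
    show "\<exists>N. \<forall>n\<ge>N. norm (of_int (s n) * g n) \<le> 2 * norm w ^ 2 * (1 / t n)"
    proof (intro exI allI impI)
      fix n assume "n \<ge> N"
      from bound[OF this] show "norm (of_int (s n) * g n) \<le> 2 * norm w ^ 2 * (1 / t n)"
        using s[of n] by auto
    qed
    show "summable (\<lambda>n. 2 * norm w ^ 2 * (1 / t n))"
      by (intro summable_mult t_sum)
  qed
  hence conv: "convergent_prod (\<lambda>n. exp (of_int (s n) * g n))"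
    by (rule convergent_prod_exp)
  have eq: "(exp w * (1 - w / of_real (t n)) powr of_real (t n)) powi s n = exp (of_int (s n) * g n)"
    if n: "n \<ge> N" for n
  proof -
    have "1 - w / of_real (t n) \<noteq> 0"
      using small[OF n] by auto
    hence "exp w * (1 - w / of_real (t n)) powr of_real (t n) = exp (g n)"
      by (simp add: g_def powr_def exp_add)
    thus ?thesis using s[of n] by (auto simp: exp_minus)
  qed
  have "convergent_prod (\<lambda>n. (exp w * (1 - w / of_real (t (n+N))) powr of_real (t (n+N))) powi s (n+N))"
    using conv[THEN convergent_prod_ignore_initial_segment, of N] eq by simp
  thus ?thesis by (rule convergent_prod_offset)
qed

lemma summable_inverse_square_Suc: "summable (\<lambda>n. 1 / real (n + 1) ^ 2)"
  using inverse_power_summable[of 2, where 'a = real]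
  by (subst summable_iff_shift) (simp add: inverse_eq_divide)

lemma convergent_prod_triple_sine:
  fixes x :: complex
  shows "convergent_prod (\<lambda>n. exp (x^2) * (1 - x^2 / of_nat (n + 1) ^ 2) ^ ((n + 1) ^ 2))"
proof -
  have "convergent_prod (\<lambda>n. (exp (x^2) * (1 - x^2 / of_real (real (n+1) ^ 2))
          powr of_real (real (n+1) ^ 2)) powi 1)"
    using summable_inverse_square_Suc by (intro convergent_prod_exp_powr) auto
  moreover have "(exp (x^2) * (1 - x^2 / of_real (real (n+1) ^ 2)) powr of_real (real (n+1) ^ 2)) powi 1
      = exp (x^2) * (1 - x^2 / of_nat (n + 1) ^ 2) ^ ((n + 1) ^ 2)" for n
  proof -
    have "z powr of_real (real (n+1) ^ 2) = z ^ ((n+1)^2)" for z :: complex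
      using powr_nat'[of z "(n+1)^2"] by simp
    thus ?thesis by simp
  qed
  ultimately show ?thesis by simp
qed

lemma convergent_prod_triple_cosine:
  fixes x :: complex
  shows "convergent_prod (\<lambda>n. exp (x^2) *
           (1 - 4 * x^2 / of_nat (2 * n + 1) ^ 2) powr (of_nat (2 * n + 1) ^ 2 / 4))"
proof -
  have "summable (\<lambda>n. 1 / (real (2*n+1) ^ 2 / 4))"
  proof (rule summable_comparison_test)
    show "summable (\<lambda>n. 4 * (1 / real (n + 1) ^ 2))"
      by (intro summable_mult summable_inverse_square_Suc)
    show "\<exists>N. \<forall>n\<ge>N. norm (1 / (real (2*n+1) ^ 2 / 4)) \<le> 4 * (1 / real (n + 1) ^ 2)"
      by (auto intro!: exI[of _ 0] divide_left_mono power_mono simp: mult_pos_pos)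
  qed
  hence "convergent_prod (\<lambda>n. (exp (x^2) * (1 - x^2 / of_real (real (2*n+1) ^ 2 / 4))
          powr of_real (real (2*n+1) ^ 2 / 4)) powi 1)"
    by (intro convergent_prod_exp_powr) auto
  thus ?thesis by (simp add: mult.commute)
qed

lemma triple_cosine_power8:
  "triple_cosine x ^ 8 =
     (\<Prod>n. exp (8 * x^2) * (1 - 4 * x^2 / of_nat (2 * n + 1) ^ 2) ^ (2 * (2 * n + 1) ^ 2))"
proof -
  have pw: "(z powr (of_nat (2*n+1) ^ 2 / 4)) ^ 8 = z ^ (2 * (2*n+1)^2)" for z :: complex and n
  proof (cases "z = 0")
    case False
    have "(z powr (of_nat (2*n+1) ^ 2 / 4)) ^ 8 = z powr (8 * (of_nat (2*n+1) ^ 2 / 4))"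
      using powr_power[of z "of_nat (2*n+1) ^ 2 / 4" 8] False by (simp add: mult_ac)
    also have "8 * (of_nat (2*n+1) ^ 2 / 4) = (of_nat (2 * (2*n+1)^2) :: complex)"
      by simp
    also have "z powr \<dots> = z ^ (2 * (2*n+1)^2)"
      using False by (intro powr_nat') auto
    finally show ?thesis .
  qed simp
  have "triple_cosine x ^ 8 = (\<Prod>n. (exp (x^2) *
          (1 - 4 * x^2 / of_nat (2 * n + 1) ^ 2) powr (of_nat (2 * n + 1) ^ 2 / 4)) ^ 8)"
    unfolding triple_cosine_def by (rule prodinf_power[OF convergent_prod_triple_cosine, symmetric])
  also have "\<dots> = (\<Prod>n. exp (8 * x^2) * (1 - 4 * x^2 / of_nat (2 * n + 1) ^ 2) ^ (2 * (2 * n + 1) ^ 2))"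
    by (intro prodinf_cong)
       (simp only: power_mult_distrib pw flip: exp_of_nat_mult, simp)
  finally show ?thesis .
qed

lemma adamchik_E_LIMSEQ:
  "(\<lambda>N. \<Prod>k=1..2*N. (1 - 4 * x^2 / of_nat k ^ 2) powi (int k ^ 2 * (-1) ^ (k + 1)))
     \<longlonglongrightarrow> adamchik_E x"
  and adamchik_E_altdef:
  "adamchik_E x =
     (\<Prod>n. (exp (4 * x^2) * (1 - 4 * x^2 / of_nat (n + 1) ^ 2) ^ ((n + 1) ^ 2)) powi ((-1) ^ n))"
proof -
  define f where "f n = (exp (4 * x^2) * (1 - 4 * x^2 / of_nat (n + 1) ^ 2) ^ ((n + 1) ^ 2)) powi ((-1) ^ n)"
    for n
  define h where "h k = (1 - 4 * x^2 / of_nat k ^ 2) powi (int k ^ 2 * (-1) ^ (k + 1))" for k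
  have "convergent_prod (\<lambda>n. (exp (4*x^2) * (1 - 4*x^2 / of_real (real (n+1) ^ 2))
          powr of_real (real (n+1) ^ 2)) powi (-1) ^ n)"
    using summable_inverse_square_Suc
    by (intro convergent_prod_exp_powr) (auto simp: minus_one_power_iff)
  moreover have "z powr of_real (real (n+1) ^ 2) = z ^ ((n+1)^2)" for z :: complex and n
    using powr_nat'[of z "(n+1)^2"] by simp
  ultimately have conv: "convergent_prod f"
    by (simp add: f_def [abs_def])
  have fh: "f n = exp (4 * x^2) powi ((-1) ^ n) * h (n + 1)" for n
  proof -
    have "z powi (int (n+1) ^ 2 * (-1) ^ n) = (z ^ ((n+1)^2)) powi ((-1) ^ n)" for z :: complex
      by (simp add: power_int_mult flip: power_int_of_nat)
    thus ?thesis by (simp add: f_def h_def power_int_mult_distrib)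
  qed
  have "(\<Prod>k<2*N. f k) = (\<Prod>k=1..2*N. h k)" for N
  proof (induction N)
    case (Suc N)
    have "f (2*N) * f (Suc (2*N)) = h (Suc (2*N)) * h (Suc (Suc (2*N)))"
      by (simp add: fh)
    with Suc show ?case by (simp add: mult_ac)
  qed simp
  moreover have "filterlim (\<lambda>N. 2 * N :: nat) sequentially sequentially"
    by (rule filterlim_subseq) (auto simp: strict_mono_def)
  moreover have "(\<lambda>n. \<Prod>k<n. f k) \<longlonglongrightarrow> prodinf f"
    using convergent_prod_has_prod[OF conv] by (rule has_prod_imp_tendsto')
  ultimately have "(\<lambda>N. \<Prod>k=1..2*N. h k) \<longlonglongrightarrow> prodinf f"
    using filterlim_compose[of "\<lambda>n. \<Prod>k<n. f k" "nhds (prodinf f)" sequentially "\<lambda>N. 2 * N"]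
    by simp
  moreover from this have "adamchik_E x = prodinf f"
    unfolding adamchik_E_def h_def by (rule limI)
  ultimately show "(\<lambda>N. \<Prod>k=1..2*N. (1 - 4 * x^2 / of_nat k ^ 2) powi (int k ^ 2 * (-1) ^ (k + 1)))
     \<longlonglongrightarrow> adamchik_E x"
    and "adamchik_E x =
     (\<Prod>n. (exp (4 * x^2) * (1 - 4 * x^2 / of_nat (n + 1) ^ 2) ^ ((n + 1) ^ 2)) powi ((-1) ^ n))"
    by (simp_all add: h_def f_def [abs_def])
qed

end

theory Submission
  imports Defs
begin

text \<open>
  Let \<open>a\<^sub>k = exp (4 x\<^sup>2) (1 - 4 x\<^sup>2 / k\<^sup>2) ^ (k\<^sup>2)\<close>. Grouping consecutive factors turns \<open>E(x)\<close> into the product of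
  \<open>a\<^sub>k / a\<^sub>k\<^sub>+\<^sub>1\<close> over odd \<open>k\<close>. Up to powers of \<open>exp (x\<^sup>2)\<close>, the product of all \<open>a\<^sub>k\<close> is \<open>S\<^sub>3(2x)\<close>, the product
  of \<open>a\<^sub>k\<^sup>2\<close> over even \<open>k\<close> is \<open>S\<^sub>3(x) ^ 8\<close> and the product of \<open>a\<^sub>k\<^sup>2\<close> over odd \<open>k\<close> is \<open>C\<^sub>3(x) ^ 8\<close>. So both
  identities hold factor by factor, and only the multiplication of limits remains. Meromorphy
  follows from the fact that \<open>S\<^sub>3\<close> is entire and not identically zero.
\<close>

section \<open>Holomorphy and zeros of the triple sine function\<close>

text \<open>In the logarithm, \<open>w\<close> cancels the linear term of
  \<open>t * Ln (1 - w / t)\<close>, leaving a remainder of norm at most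
  \<open>2 * norm w ^ 2 / t\<close>. The second hypothesis keeps this below 1/2, where passing to
  \<open>exp\<close> costs a factor 3/2. The bound depends on \<open>w\<close> only through its
  norm, as the M-test below requires.\<close>

lemma norm_exp_times_one_minus_power_le:
  fixes w :: complex and t :: nat
  assumes t: "2 * norm w < real t" "4 * norm w ^ 2 \<le> real t"
  shows "norm (exp w * (1 - w / of_nat t) ^ t - 1) \<le> 3 * norm w ^ 2 / real t"
proof -
  define z where "z = - (w / of_nat t)"
  define g where "g = of_nat t * (Ln (1 + z) - z)"
  have pos: "real t > 0"
    using t(1) norm_ge_zero[of w] by linarith
  have z: "norm z < 1/2"
    using t(1) pos by (simp add: z_def norm_divide field_simps)
  have "1 + z \<noteq> 0"
    using z by (auto simp: add_eq_0_iff)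
  hence "exp (of_nat t * Ln (1 + z)) = (1 + z) ^ t"
    by (simp add: exp_of_nat_mult)
  moreover have "g = of_nat t * Ln (1 + z) + w"
    using pos by (simp add: g_def z_def algebra_simps)
  ultimately have eq: "exp w * (1 - w / of_nat t) ^ t = exp g"
    by (simp add: exp_add z_def mult.commute)
  have "norm g = real t * norm (Ln (1 + z) - z)"
    by (simp add: g_def norm_mult)
  also have "\<dots> \<le> real t * (norm z ^ 2 / (1 - norm z))"
    using z by (intro mult_left_mono Ln_approx_linear) auto
  also have "\<dots> \<le> real t * (norm z ^ 2 / (1/2))"
    using z by (intro mult_left_mono divide_left_mono) auto
  also have "\<dots> = 2 * norm w ^ 2 / real t"
    using pos by (simp add: z_def norm_divide field_simps power2_eq_square)
  finally have g: "norm g \<le> 2 * norm w ^ 2 / real t" .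
  also have "\<dots> \<le> 1 / 2"
    using t(2) pos by (simp add: field_simps)
  finally have "norm (exp g - 1) \<le> 3 / 2 * norm g"
    by (rule norm_exp_bounds)
  with g eq show ?thesis by simp
qed

text \<open>The partial products converge uniformly on every closed disc of radius 1, by the M-test
  with a multiple of \<open>1 / (n + 1) ^ 2\<close> as majorant.\<close>

lemma triple_sine_holomorphic: "triple_sine holomorphic_on UNIV"
proof -
  define f where "f n x = exp (x^2) * (1 - x^2 / of_nat (n + 1) ^ 2) ^ ((n + 1) ^ 2)"
    for n and x :: complex
  define P where "P x = (\<Prod>n. f n x)" for x
  have "P holomorphic_on UNIV"
  proof (rule holomorphic_uniform_sequence)
    show "(\<lambda>x. \<Prod>n<N. f n x) holomorphic_on UNIV" for N
      unfolding f_def by (intro holomorphic_intros) (auto simp del: of_nat_Suc)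
    fix x0 :: complex
    have "uniformly_convergent_on (cball x0 1) (\<lambda>N x. \<Prod>n<N. f n x)"
    proof (rule uniformly_convergent_on_prod')
      show "continuous_on (cball x0 1) (f n)" for n
        unfolding f_def by (intro continuous_intros) (auto simp del: of_nat_Suc)
      define R where "R = (norm x0 + 1) ^ 2"
      have R: "norm (x ^ 2) \<le> R" if "x \<in> cball x0 1" for x
        unfolding R_def norm_power
        using that norm_triangle_ineq2[of x x0] by (intro power_mono) (auto simp: dist_norm norm_minus_commute)
      \<comment> \<open>The sum covers both hypotheses of the norm estimate at once, for
        \<open>t = (n + 1) ^ 2\<close>, which is at least \<open>n\<close>.\<close>
      have "\<forall>\<^sub>F n in sequentially. 2 * R + 4 * R ^ 2 < real n"
        by real_asymp
      hence "\<forall>\<^sub>F n in sequentially. \<forall>x\<in>cball x0 1.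
               norm (norm (f n x - 1)) \<le> 3 * R ^ 2 * (1 / real (n + 1) ^ 2)"
      proof eventually_elim
        case (elim n)
        show ?case
        proof
          fix x assume x: "x \<in> cball x0 1"
          have sq: "norm (x ^ 2) ^ 2 \<le> R ^ 2"
            using R[OF x] by (intro power_mono) auto
          have "real n \<le> real ((n + 1) ^ 2)"
            unfolding of_nat_le_iff by (simp add: power2_eq_square)
          hence "2 * R + 4 * R ^ 2 < real ((n + 1) ^ 2)"
            using elim by linarith
          moreover have "R \<ge> 0" "R ^ 2 \<ge> 0"
            by (simp_all add: R_def)
          ultimately have "norm (exp (x^2) * (1 - x^2 / of_nat ((n + 1) ^ 2)) ^ ((n + 1) ^ 2) - 1)
                  \<le> 3 * norm (x^2) ^ 2 / real ((n + 1) ^ 2)"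
            using R[OF x] sq by (intro norm_exp_times_one_minus_power_le) linarith+
          also have "\<dots> \<le> 3 * R ^ 2 / real ((n + 1) ^ 2)"
            using sq by (intro divide_right_mono) auto
          finally show "norm (norm (f n x - 1)) \<le> 3 * R ^ 2 * (1 / real (n + 1) ^ 2)"
            by (simp add: f_def)
        qed
      qed
      thus "uniformly_convergent_on (cball x0 1) (\<lambda>N x. \<Sum>n<N. norm (f n x - 1))"
        by (rule Weierstrass_m_test'_ev) (intro summable_mult summable_inverse_square_Suc)
    qed auto
    hence "uniform_limit (cball x0 1) (\<lambda>N x. \<Prod>n<N. f n x) (\<lambda>x. lim (\<lambda>N. \<Prod>n<N. f n x)) sequentially"
      by (simp only: uniformly_convergent_uniform_limit_iff)
    moreover have "lim (\<lambda>N. \<Prod>n<N. f n x) = P x" for x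
      unfolding P_def f_def
      by (intro limI has_prod_imp_tendsto' convergent_prod_has_prod convergent_prod_triple_sine)
    ultimately have "uniform_limit (cball x0 1) (\<lambda>N x. \<Prod>n<N. f n x) P sequentially"
      by simp
    thus "\<exists>d>0. cball x0 d \<subseteq> UNIV \<and> uniform_limit (cball x0 d) (\<lambda>N x. \<Prod>n<N. f n x) P sequentially"
      by (intro exI[of _ 1]) auto
  qed auto
  hence "(\<lambda>x. exp (x^2 / 2) * P x) holomorphic_on UNIV"
    by (intro holomorphic_intros) auto
  thus ?thesis
    by (simp add: triple_sine_def [abs_def] P_def f_def)
qed

lemma triple_sine_0: "triple_sine 0 = 1"
  by (simp add: triple_sine_def)

text \<open>On a connected domain a meromorphic function takes a given value either almost
  everywhere or almost nowhere; continuity and the value 1 at the origin exclude the former for the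
  value 0.\<close>

lemma eventually_triple_sine_nonzero: "\<forall>\<^sub>\<approx>x\<in>UNIV. triple_sine x \<noteq> 0"
proof -
  have "triple_sine meromorphic_on UNIV"
    using triple_sine_holomorphic by (intro analytic_on_imp_meromorphic_on) (simp add: analytic_on_open)
  hence "(\<forall>\<^sub>\<approx>x\<in>UNIV. triple_sine x = 0) \<or> (\<forall>\<^sub>\<approx>x\<in>UNIV. triple_sine x \<noteq> 0)"
    by (rule meromorphic_imp_constant_or_avoid) auto
  moreover have "\<not> (\<forall>\<^sub>\<approx>x\<in>UNIV. triple_sine x = 0)"
  proof
    assume "\<forall>\<^sub>\<approx>x\<in>UNIV. triple_sine x = 0"
    hence "\<forall>\<^sub>F x in at 0. triple_sine x = 0"
      by (rule eventually_cosparse_imp_eventually_at) auto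
    hence "triple_sine \<midarrow>0\<rightarrow> 0"
      by (rule tendsto_eventually)
    moreover have "isCont triple_sine 0"
      using holomorphic_on_imp_continuous_on[OF triple_sine_holomorphic]
      by (simp add: continuous_on_eq_continuous_at)
    hence "triple_sine \<midarrow>0\<rightarrow> 1"
      by (simp add: isCont_def triple_sine_0)
    ultimately show False
      using LIM_unique by fastforce
  qed
  ultimately show ?thesis by blast
qed

section \<open>Limits of products of sine factors\<close>

text \<open>This is the factor with \<open>k = n + 1\<close> of the overview, so even indices
  \<open>n\<close> belong to odd \<open>k\<close>.\<close>

definition sine_factor :: "complex \<Rightarrow> nat \<Rightarrow> complex" where
  "sine_factor x n = exp (4 * x^2) * (1 - 4 * x^2 / of_nat (n + 1) ^ 2) ^ ((n + 1) ^ 2)"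

lemma sine_factor_prod:
  "sine_factor x has_prod (exp (- (2 * x^2)) * triple_sine (2 * x))"
proof -
  have "(\<lambda>n. exp ((2*x)^2) * (1 - (2*x)^2 / of_nat (n + 1) ^ 2) ^ ((n + 1) ^ 2)) = sine_factor x"
    by (simp add: sine_factor_def fun_eq_iff power_mult_distrib)
  thus ?thesis
    using convergent_prod_has_prod[OF convergent_prod_triple_sine[of "2 * x"]]
    by (simp add: triple_sine_def power_mult_distrib exp_minus field_simps)
qed

lemma prod_pairs: "(\<Prod>k<2*N. g k) = (\<Prod>m<N. g (2*m) * g (2*m+1))"
  for g :: "nat \<Rightarrow> 'a :: comm_monoid_mult"
  by (induction N) (simp_all add: mult_ac)

text \<open>Pairing gives all the limits below the same shape, a product over \<open>m < N\<close>,
  so that they can be multiplied factor by factor.\<close>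

lemma has_prod_imp_tendsto_pairs:
  fixes g :: "nat \<Rightarrow> 'a :: {semidom, t2_space}"
  assumes "g has_prod p"
  shows "(\<lambda>N. \<Prod>m<N. g (2*m) * g (2*m+1)) \<longlonglongrightarrow> p"
proof -
  have "filterlim (\<lambda>N. 2 * N :: nat) sequentially sequentially"
    by (rule filterlim_subseq) (auto simp: strict_mono_def)
  from filterlim_compose[OF has_prod_imp_tendsto'[OF assms] this] show ?thesis
    by (simp only: prod_pairs)
qed

lemma sine_factor_LIMSEQ:
  "(\<lambda>N. \<Prod>m<N. sine_factor x (2*m) * sine_factor x (2*m+1))
     \<longlonglongrightarrow> exp (- (2 * x^2)) * triple_sine (2 * x)"
  by (intro has_prod_imp_tendsto_pairs sine_factor_prod)

text \<open>The two exponentials in each quotient cancel. Vanishing factors do no harm: negative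
  integer powers and division share the convention \<open>inverse 0 = 0\<close>.\<close>

lemma adamchik_E_sine_factor_LIMSEQ:
  "(\<lambda>N. \<Prod>m<N. sine_factor x (2*m) / sine_factor x (2*m+1)) \<longlonglongrightarrow> adamchik_E x"
proof -
  define h where "h k = (1 - 4 * x^2 / of_nat k ^ 2) powi (int k ^ 2 * (-1) ^ (k + 1))" for k
  have "(\<Prod>k=1..2*N. h k) = (\<Prod>m<N. h (2*m+1) * h (2*m+2))" for N
    by (induction N) (simp_all add: mult_ac)
  moreover have "h (2*m+1) * h (2*m+2) = sine_factor x (2*m) / sine_factor x (2*m+1)" for m
  proof -
    have eq: "int k ^ 2 = int (k ^ 2)" for k
      by simp
    have "h (2*m+1) = (1 - 4 * x^2 / of_nat (2*m+1) ^ 2) ^ ((2*m+1)^2)"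
      unfolding h_def eq by (simp del: of_nat_power add: power_int_of_nat)
    moreover have "h (2*m+2) = inverse ((1 - 4 * x^2 / of_nat (2*m+2) ^ 2) ^ ((2*m+2)^2))"
      unfolding h_def eq by (simp del: of_nat_power add: power_int_of_nat power_int_minus)
    ultimately show ?thesis
      by (simp add: sine_factor_def divide_inverse)
  qed
  ultimately show ?thesis
    using adamchik_E_LIMSEQ(1)[of x] by (simp add: h_def)
qed

text \<open>For \<open>k = 2 * (m + 1)\<close> the base is that of the factor \<open>s m\<close> of
  the triple sine at \<open>x\<close>, and the exponent is \<open>4 * (m + 1) ^ 2\<close>; hence the
  sine factor is \<open>s m ^ 4\<close>. The outer exponential is the eighth power of the prefactor
  \<open>exp (x^2 / 2)\<close>, moved to the other side.\<close>

lemma triple_sine_power8_LIMSEQ: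
  "(\<lambda>N. \<Prod>m<N. sine_factor x (2*m+1) ^ 2) \<longlonglongrightarrow> exp (- (4 * x^2)) * triple_sine x ^ 8"
proof -
  define s where "s n = exp (x^2) * (1 - x^2 / of_nat (n + 1) ^ 2) ^ ((n + 1) ^ 2)" for n
  have "sine_factor x (2*m+1) ^ 2 = s m ^ 8" for m
  proof -
    have "4 * x^2 / of_nat (2*m+2) ^ 2 = x^2 / of_nat (m+1) ^ 2"
    proof -
      have "(of_nat (2*m+2) :: complex) = 2 * of_nat (m+1)"
        by simp
      thus ?thesis
        by (simp only: power_mult_distrib) simp
    qed
    moreover have "(2*m+2)^2 * 2 = 8 * (m+1)^2"
      by (simp add: power2_eq_square algebra_simps)
    moreover have "exp (4 * x^2) ^ 2 = exp (x^2) ^ 8"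
      by (simp flip: exp_of_nat_mult)
    ultimately show ?thesis
      by (simp add: sine_factor_def s_def power_mult_distrib mult.commute flip: power_mult)
  qed
  moreover have "(\<lambda>N. (\<Prod>m<N. s m) ^ 8) \<longlonglongrightarrow> prodinf s ^ 8"
    unfolding s_def
    by (intro tendsto_power has_prod_imp_tendsto' convergent_prod_has_prod convergent_prod_triple_sine)
  moreover have "prodinf s ^ 8 = exp (- (4 * x^2)) * triple_sine x ^ 8"
  proof -
    have "exp (x^2 / 2) ^ 8 = exp (4 * x^2)"
      by (simp flip: exp_of_nat_mult)
    thus ?thesis
      by (simp add: triple_sine_def s_def [abs_def] power_mult_distrib exp_minus)
  qed
  ultimately show ?thesis
    by (simp add: prod_power_distrib)
qed

lemma triple_cosine_power8_LIMSEQ: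
  "(\<lambda>N. \<Prod>m<N. sine_factor x (2*m) ^ 2) \<longlonglongrightarrow> triple_cosine x ^ 8"
proof -
  define c where "c n = exp (x^2) * (1 - 4 * x^2 / of_nat (2 * n + 1) ^ 2) powr (of_nat (2 * n + 1) ^ 2 / 4)"
    for n
  have "c m ^ 8 = sine_factor x (2*m) ^ 2" for m
  proof -
    have "(z powr (of_nat (2*m+1) ^ 2 / 4)) ^ 8 = (z ^ ((2*m+1)^2)) ^ 2" for z :: complex
    \<comment> \<open>At \<open>z = 0\<close> both sides vanish, since \<open>0 powr a = 0\<close>
      and the integer exponents are positive. Elsewhere the factor 8 clears the denominator 4, and
      the branch no longer matters.\<close>
    proof (cases "z = 0")
      case False
      have "(z powr (of_nat (2*m+1) ^ 2 / 4)) ^ 8 = z powr (8 * (of_nat (2*m+1) ^ 2 / 4))"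
        using powr_power[of z "of_nat (2*m+1) ^ 2 / 4" 8] False by (simp add: mult_ac)
      also have "8 * (of_nat (2*m+1) ^ 2 / 4) = (of_nat ((2*m+1)^2 * 2) :: complex)"
        by simp
      also have "z powr \<dots> = z ^ ((2*m+1)^2 * 2)"
        using False by (intro powr_nat') auto
      finally show ?thesis
        by (simp only: power_mult)
    qed simp
    moreover have "exp (x^2) ^ 8 = exp (4 * x^2) ^ 2"
      by (simp flip: exp_of_nat_mult)
    ultimately show ?thesis
      by (simp only: c_def sine_factor_def power_mult_distrib)
  qed
  moreover have "(\<lambda>N. (\<Prod>m<N. c m) ^ 8) \<longlonglongrightarrow> triple_cosine x ^ 8"
    unfolding c_def triple_cosine_def
    by (intro tendsto_power has_prod_imp_tendsto' convergent_prod_has_prod convergent_prod_triple_cosine)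
  ultimately show ?thesis
    by (simp add: prod_power_distrib)
qed

section \<open>The two identities with denominators cleared\<close>

text \<open>Factor by factor this is \<open>a / b * b ^ 2 = a * b\<close>, which is true for
  \<open>b = 0\<close> as well; the identity therefore covers the zeros of the triple sine.\<close>

lemma adamchik_E_mult_triple_sine_power8:
  "adamchik_E x * triple_sine x ^ 8 = exp (2 * x^2) * triple_sine (2 * x)"
proof -
  have "sine_factor x (2*m) / sine_factor x (2*m+1) * sine_factor x (2*m+1) ^ 2
          = sine_factor x (2*m) * sine_factor x (2*m+1)" for m
    by (simp add: power2_eq_square)
  with tendsto_mult[OF adamchik_E_sine_factor_LIMSEQ triple_sine_power8_LIMSEQ, of x x]
  have "(\<lambda>N. \<Prod>m<N. sine_factor x (2*m) * sine_factor x (2*m+1))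
          \<longlonglongrightarrow> adamchik_E x * (exp (- (4 * x^2)) * triple_sine x ^ 8)"
    by (simp flip: prod.distrib)
  hence "adamchik_E x * (exp (- (4 * x^2)) * triple_sine x ^ 8)
           = exp (- (2 * x^2)) * triple_sine (2 * x)"
    using sine_factor_LIMSEQ LIMSEQ_unique by blast
  moreover have "exp (4 * x^2) = exp (2 * x^2) * exp (2 * x^2)"
    by (simp flip: exp_add)
  ultimately show ?thesis
    by (simp add: exp_minus field_simps)
qed

lemma adamchik_E_mult_triple_sine:
  assumes "triple_sine (2 * x) \<noteq> 0"
  shows "adamchik_E x * triple_sine (2 * x) = exp (2 * x^2) * triple_cosine x ^ 8"
proof -
  \<comment> \<open>The cancellation \<open>a / b * (a * b) = a ^ 2\<close> needs
    \<open>b \<noteq> 0\<close>. A single zero factor would make the whole product, and with it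
    \<open>triple_sine (2 * x)\<close>, vanish.\<close>
  have "sine_factor x n \<noteq> 0" for n
    using has_prod_zeroI[OF sine_factor_prod[of x], of n] assms by auto
  hence "sine_factor x (2*m) / sine_factor x (2*m+1) * (sine_factor x (2*m) * sine_factor x (2*m+1))
          = sine_factor x (2*m) ^ 2" for m
    by (simp add: power2_eq_square)
  with tendsto_mult[OF adamchik_E_sine_factor_LIMSEQ sine_factor_LIMSEQ, of x x]
  have "(\<lambda>N. \<Prod>m<N. sine_factor x (2*m) ^ 2)
          \<longlonglongrightarrow> adamchik_E x * (exp (- (2 * x^2)) * triple_sine (2 * x))"
    by (simp flip: prod.distrib)
  hence "adamchik_E x * (exp (- (2 * x^2)) * triple_sine (2 * x)) = triple_cosine x ^ 8"
    using triple_cosine_power8_LIMSEQ LIMSEQ_unique by blast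
  thus ?thesis
    by (auto simp: exp_minus field_simps)
qed

section \<open>Quotient form and meromorphy\<close>

theorem theorem2:
  shows "adamchik_E meromorphic_on UNIV
    \<and> (\<lambda>x. exp (2 * x^2) * (triple_sine (2 * x) / triple_sine x ^ 8)) meromorphic_on UNIV
    \<and> (\<lambda>x. exp (2 * x^2) * (triple_cosine x ^ 8 / triple_sine (2 * x))) meromorphic_on UNIV
    \<and> (\<forall>\<^sub>\<approx>x\<in>UNIV.
          adamchik_E x = exp (2 * x^2) * (triple_sine (2 * x) / triple_sine x ^ 8)
        \<and> exp (2 * x^2) * (triple_sine (2 * x) / triple_sine x ^ 8)
            = exp (2 * x^2) * (triple_cosine x ^ 8 / triple_sine (2 * x)))
    \<and> (\<forall>x. triple_sine x \<noteq> 0 \<longrightarrow>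
          adamchik_E x = exp (2 * x^2) * (triple_sine (2 * x) / triple_sine x ^ 8))
    \<and> (\<forall>x. triple_sine (2 * x) \<noteq> 0 \<longrightarrow>
          adamchik_E x = exp (2 * x^2) * (triple_cosine x ^ 8 / triple_sine (2 * x)))"
proof -
  define F where "F x = exp (2 * x^2) * (triple_sine (2 * x) / triple_sine x ^ 8)" for x
  define G where "G x = exp (2 * x^2) * (triple_cosine x ^ 8 / triple_sine (2 * x))" for x
  have EF: "adamchik_E x = F x" if "triple_sine x \<noteq> 0" for x
    using adamchik_E_mult_triple_sine_power8[of x] that by (simp add: F_def field_simps)
  have EG: "adamchik_E x = G x" if "triple_sine (2 * x) \<noteq> 0" for x
    using adamchik_E_mult_triple_sine[OF that] that by (simp add: G_def field_simps)
  have F: "F meromorphic_on UNIV"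
  proof -
    have "triple_sine analytic_on UNIV"
      using triple_sine_holomorphic by (simp add: analytic_on_open)
    moreover have "(\<lambda>x. triple_sine (2 * x)) analytic_on UNIV"
      using holomorphic_on_compose_gen[OF _ triple_sine_holomorphic, of "\<lambda>x. 2 * x" UNIV]
      by (simp add: analytic_on_open o_def holomorphic_intros)
    moreover have "(\<lambda>x::complex. exp (2 * x^2)) analytic_on UNIV"
      by (intro analytic_intros)
    ultimately show ?thesis
      unfolding F_def by (intro meromorphic_intros analytic_on_imp_meromorphic_on)
  qed
  have nz: "\<forall>\<^sub>\<approx>x\<in>UNIV. triple_sine (2 * x) \<noteq> 0"
    \<comment> \<open>Sparseness of the zeros is local, so it can be pulled back along
      \<open>y \<mapsto> 2 * y\<close>, which maps punctured neighbourhoods of \<open>x\<close> into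
      those of \<open>2 * x\<close>.\<close>
    unfolding eventually_cosparse_open_eq[OF open_UNIV]
  proof
    fix x :: complex
    have "\<forall>\<^sub>F y in at (2 * x). triple_sine y \<noteq> 0"
      using eventually_triple_sine_nonzero by (simp add: eventually_cosparse_open_eq)
    moreover have "filterlim (\<lambda>y. 2 * y) (at (2 * x)) (at x)"
      by (intro filterlim_atI tendsto_intros) (auto simp: eventually_at_filter)
    ultimately show "\<forall>\<^sub>F y in at x. triple_sine (2 * y) \<noteq> 0"
      by (rule eventually_compose_filterlim)
  qed
  have ev: "\<forall>\<^sub>\<approx>x\<in>UNIV. adamchik_E x = F x \<and> F x = G x"
    using nz eventually_triple_sine_nonzero by eventually_elim (use EF EG in metis)
  \<comment> \<open>\<open>F\<close> is a quotient of entire functions. \<open>adamchik_E\<close>,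
    defined as a pointwise limit, and \<open>G\<close>, whose numerator involves principal branches,
    inherit meromorphy by agreeing with \<open>F\<close> off a sparse set.\<close>
  have "adamchik_E meromorphic_on UNIV"
    using F meromorphic_on_cong'[OF eventually_mono[OF ev], of adamchik_E F UNIV] by simp
  moreover have "G meromorphic_on UNIV"
    using F meromorphic_on_cong'[OF eventually_mono[OF ev], of F G UNIV] by simp
  ultimately show ?thesis
    using F ev EF EG unfolding F_def G_def by blast
qed

end
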